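(* If $P = P_1 P_2$, where $P_1$ is a Dyck suffix and $P_2$ is a Dyck prefix, then $$ f(P) = f(P_1)\, f(d P_2). $$
   Context: A (binary) path of length $n$ is a lattice path $P=p_1\cdots p_n$ starting at the origin, each step being an upstep $u=(1,1)$ or a downstep $d=(1,-1)$; $|P|=n$ is its length, $\mathcal{P}_n$ the set of paths of length $n$ (with $\mathcal{P}_0$ consisting only of the empty path $\varepsilon$), $\mathcal{P}=\bigcup_{n\ge0}\mathcal{P}_n$, and $[k]=\{1,\dots,k\}$. Juxtaposition denotes concatenation of step sequences; each path is regarded as starting at the origin. $\mathcal{P}_n$ is ordered by $P\le Q$ iff $P$ lies weakly below $Q$ (at each abscissa the height, i.e. $y$-coordinate, of $P$ is at most that of $Q$); its maximum is $\mathbf{1}_n=u^n$. A valley of $P$ is the last point of a maximal run of $d$'s: it is either the middle point of an occurrence of $du$, or the endpoint of $P$ when $P$ ends with $d$. Turning a valley into a peak means replacing the corresponding $du$ by $ud$ (or, for a valley at the end of the path, the final $d$ by $u$). The filling of $P$ is the path $\widetilde P$ obtained by turning every valley of $P$ into a peak (so $\widetilde{\mathbf 1_n}=\mathbf 1_n$). Put $P^{(0)}=P$, $P^{(i)}=\widetilde{P^{(i-1)}}$; the degree $\delta(P)$ is the least $k\ge0$ with $P^{(k)}=\mathbf 1_{|P|}$. A chain $P_0\le P_1\le\cdots\le P_k$ (of length $k$) has small intervals if for each $i\in[k]$ the path $P_i$ is obtained from $P_{i-1}$ by turning some valleys of $P_{i-1}$ into peaks (equivalently $P_{i-1}\le P_i\le\widetilde{P_{i-1}}$).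 $f(P)$ is the number of chains of length $\delta(P)$ with small intervals from $P$ to $\mathbf 1_{|P|}$. A Dyck path is a path that ends at height $0$ and never goes below height $0$ (the empty path $\varepsilon$ is a Dyck path). A Dyck prefix (resp. Dyck suffix) is a path whose step sequence is a prefix (resp. suffix) of that of a Dyck path.
   Formalization: The formal statement also assumes that P_1 is nonempty; for empty P_1 the claim fails, e.g. P_2 = uud gives f(uud) = 1 but f(ε) f(duud) = 2. *)

theory Defs
  imports Main "HOL-Library.Sublist"
begin

datatype step = U | D

type_synonym path = "step list"

fun rise :: "step \<Rightarrow> int" where
  "rise U = 1"
| "rise D = - 1"

definition height :: "path \<Rightarrow> nat \<Rightarrow> int" where
  "height P i = sum_list (map rise (take i P))"

definition weakly_below :: "path \<Rightarrow> path \<Rightarrow> bool" where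
  "weakly_below P Q \<longleftrightarrow>
     length P = length Q \<and> (\<forall>i \<le> length P. height P i \<le> height Q i)"

definition top_path :: "nat \<Rightarrow> path" where
  "top_path n = replicate n U"

(* A valley is given by its abscissa i; the step ending there is P ! (i - 1)
   and the step starting there, if any, is P ! i. *)
definition valleys :: "path \<Rightarrow> nat set" where
  "valleys P = {i. 1 \<le> i \<and> i \<le> length P \<and> P ! (i - 1) = D \<and>
     (i = length P \<or> P ! i = U)}"

(* Turns the valleys with abscissae in S into peaks, for S a subset of valleys P.
   Index j carries the step from abscissa j to abscissa j + 1.  No index falls under
   both of the first two cases, as two valleys are never at consecutive abscissae. *)
definition turn_valleys :: "path \<Rightarrow> nat set \<Rightarrow> path" where
  "turn_valleys P S =
     map (\<lambda>j. if Suc j \<in> S then U else if j \<in> S then D else P ! j) [0..<length P]"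

definition filling :: "path \<Rightarrow> path" where
  "filling P = turn_valleys P (valleys P)"

definition degree :: "path \<Rightarrow> nat" where
  "degree P = (LEAST k. (filling ^^ k) P = top_path (length P))"

(* Chains are weak: consecutive elements may coincide (S = {} below). *)
definition small_interval_chain :: "path list \<Rightarrow> bool" where
  "small_interval_chain Ps \<longleftrightarrow>
     (\<forall>i. Suc i < length Ps \<longrightarrow>
        weakly_below (Ps ! i) (Ps ! Suc i) \<and>
        (\<exists>S \<subseteq> valleys (Ps ! i). Ps ! Suc i = turn_valleys (Ps ! i) S))"

(* A chain of length k has k + 1 elements. *)
definition num_chains :: "path \<Rightarrow> nat" where
  "num_chains P = card {Ps. length Ps = Suc (degree P) \<and> hd Ps = P \<and>
     last Ps = top_path (length P) \<and> small_interval_chain Ps}"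

definition dyck_path :: "path \<Rightarrow> bool" where
  "dyck_path P \<longleftrightarrow> height P (length P) = 0 \<and> (\<forall>i \<le> length P. 0 \<le> height P i)"

(* The empty path is both a Dyck prefix and a Dyck suffix.  The product formula
   num_chains (P @ Q) = num_chains P * num_chains (D # Q), for P a Dyck suffix and Q a
   Dyck prefix, needs P to be nonempty (so that P ends with D): for P = [] and
   Q = [U, U, D] the left-hand side is 1 and the right-hand side is 2. *)
definition dyck_prefix :: "path \<Rightarrow> bool" where
  "dyck_prefix P \<longleftrightarrow> (\<exists>Q. dyck_path Q \<and> prefix P Q)"

definition dyck_suffix :: "path \<Rightarrow> bool" where
  "dyck_suffix P \<longleftrightarrow> (\<exists>Q. dyck_path Q \<and> suffix P Q)"

end

(* Raising a valley at height h forces its neighbours at height h + 1 to wait, so once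
   the initial upsteps, which never move, are removed, a chain of length degree P must raise all
   points of minimal height in every step.  When P1 is a Dyck
   suffix and P2 = U P2' a Dyck prefix, the junction is such a minimum, and its raising turns
   P1 P2 into Q U D R, where P1 goes to Q U and D P2 goes to U D R independently.  Again Q is a
   Dyck suffix and R a Dyck prefix, so induction gives
   f(Q U D R) = f(Q) f(D U D R) = f(Q) f(D U D) f(D R) = f(Q) f(D R) = f(Q U) f(U D R). *)

theory Submission
  imports Defs
begin

section \<open>Heights of paths\<close>

lemma height_0 [simp]: "height P 0 = 0"
  by (simp add: height_def)

lemma height_Nil [simp]: "height [] i = 0"
  by (simp add: height_def)

lemma height_Cons_Suc [simp]: "height (x # P) (Suc i) = rise x + height P i"
  by (simp add: height_def)

lemma height_append: "height (P @ Q) i = height P i + height Q (i - length P)"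
  by (simp add: height_def)

lemma height_Suc: "i < length P \<Longrightarrow> height P (Suc i) = height P i + rise (P ! i)"
  by (simp add: height_def take_Suc_conv_app_nth)

lemma height_beyond: "length P \<le> i \<Longrightarrow> height P i = height P (length P)"
  by (simp add: height_def)

lemma rise_le_1: "rise x \<le> 1"
  by (cases x) auto

lemma height_le: "height P i \<le> int i"
proof (induction P arbitrary: i)
  case (Cons x P)
  show ?case
  proof (cases i)
    case (Suc j)
    then show ?thesis using Cons.IH[of j] rise_le_1[of x] by simp
  qed simp
qed simp

lemma height_eq_id_imp_top:
  assumes "\<forall>i \<le> length P. height P i = int i"
  shows "P = top_path (length P)"
proof -
  have "P ! i = U" if "i < length P" for i
  proof (cases "P ! i")
    case D
    then show ?thesis using assms that height_Suc[OF that] by simp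
  qed simp
  then show ?thesis
    by (simp add: top_path_def list_eq_iff_nth_eq)
qed

lemma height_top_path: "i \<le> n \<Longrightarrow> height (top_path n) i = int i"
  by (simp add: height_def top_path_def sum_list_replicate min_def)

section \<open>Turning valleys, by abscissae and by recursion along the path\<close>

lemma length_turn_valleys [simp]: "length (turn_valleys P S) = length P"
  by (simp add: turn_valleys_def)

lemma nth_turn_valleys:
  "j < length P \<Longrightarrow>
     turn_valleys P S ! j = (if Suc j \<in> S then U else if j \<in> S then D else P ! j)"
  by (simp add: turn_valleys_def)

lemma length_filling [simp]: "length (filling P) = length P"
  by (simp add: filling_def)

lemma valleys_Suc_disjoint: "i \<in> valleys P \<Longrightarrow> Suc i \<notin> valleys P"
  by (auto simp: valleys_def)

lemma zero_notin_valleys: "0 \<notin> valleys P"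
  by (auto simp: valleys_def)

text \<open>Turning the valley at \<open>i\<close> changes the step before \<open>i\<close> from
  \<open>D\<close> to \<open>U\<close>, a gain of 2, and the step after it from \<open>U\<close> to
  \<open>D\<close>, which cancels the gain. Valleys are never adjacent, so these changes do not
  interfere.\<close>

lemma height_turn_valleys:
  assumes "S \<subseteq> valleys P" "i \<le> length P"
  shows "height (turn_valleys P S) i = height P i + (if i \<in> S then 2 else 0)"
  using assms(2)
proof (induction i)
  case 0
  then show ?case using assms(1) zero_notin_valleys by auto
next
  case (Suc i)
  then have i: "i < length P" by simp
  have nth: "turn_valleys P S ! i = (if Suc i \<in> S then U else if i \<in> S then D else P ! i)"
    using i by (simp add: nth_turn_valleys)
  have D: "P ! i = D" if "Suc i \<in> S"
    using subsetD[OF assms(1) that] by (simp add: valleys_def)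
  have U: "P ! i = U" if "i \<in> S"
    using that assms(1) i by (auto simp: valleys_def)
  have "i \<notin> S" if "Suc i \<in> S"
    using that assms(1) valleys_Suc_disjoint by blast
  then show ?case
    using Suc i nth D U by (auto simp: height_Suc)
qed

text \<open>Turning without index sets, so that paths can be peeled from the front.
  \<open>Swap\<close> consumes both steps of a turned valley, so that no step takes part in two
  turns; \<open>Last\<close> is the valley at the end of the path.\<close>

inductive turn :: "path \<Rightarrow> path \<Rightarrow> bool" where
  Nil: "turn [] []"
| Cons: "turn P Q \<Longrightarrow> turn (x # P) (x # Q)"
| Swap: "turn P Q \<Longrightarrow> turn (D # U # P) (U # D # Q)"
| Last: "turn [D] [U]"

lemma turn_length: "turn P Q \<Longrightarrow> length Q = length P"
  by (induction rule: turn.induct) auto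

lemma turn_valleys_Nil [simp]: "turn_valleys [] S = []"
  by (simp add: turn_valleys_def)

lemma turn_valleys_Cons:
  "turn_valleys (x # P) S = (if 1 \<in> S then U else if 0 \<in> S then D else x)
     # map (\<lambda>j. if Suc (Suc j) \<in> S then U else if Suc j \<in> S then D else P ! j) [0..<length P]"
  unfolding turn_valleys_def
  by (simp add: upt_conv_Cons map_Suc_upt[symmetric] del: upt_Suc)

lemma turn_valleys_Cons_vimage:
  assumes "0 \<notin> S" "1 \<notin> S"
  shows "turn_valleys (x # P) S = x # turn_valleys P (Suc -` S)"
  using assms by (auto simp: turn_valleys_Cons) (simp add: turn_valleys_def)

lemma turn_valleys_Swap_vimage:
  assumes "1 \<in> S" "2 \<notin> S"
  shows "turn_valleys (x # y # P) S = U # D # turn_valleys P (Suc -` Suc -` S)"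
  using assms
  by (auto simp: turn_valleys_Cons turn_valleys_def upt_conv_Cons map_Suc_upt[symmetric]
      numeral_2_eq_2 simp del: upt_Suc)

lemma Suc_in_valleys_Cons:
  "1 \<le> i \<Longrightarrow> Suc i \<in> valleys (x # P) \<longleftrightarrow> i \<in> valleys P"
  by (cases i) (auto simp: valleys_def)

lemma turn_imp_turn_valleys:
  "turn P Q \<Longrightarrow> \<exists>S \<subseteq> valleys P. Q = turn_valleys P S"
proof (induction rule: turn.induct)
  case (Cons P Q x)
  then obtain S where S: "S \<subseteq> valleys P" "Q = turn_valleys P S" by blast
  have pos: "1 \<le> i" if "i \<in> S" for i
    using that S(1) by (auto simp: valleys_def)
  have "Suc ` S \<subseteq> valleys (x # P)"
    using S(1) pos Suc_in_valleys_Cons by blast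
  moreover have "turn_valleys (x # P) (Suc ` S) = x # turn_valleys P S"
    using pos by (subst turn_valleys_Cons_vimage) (fastforce simp: inj_vimage_image_eq)+
  ultimately show ?case using S by metis
next
  case (Swap P Q)
  then obtain S where S: "S \<subseteq> valleys P" "Q = turn_valleys P S" by blast
  have pos: "1 \<le> i" if "i \<in> S" for i
    using that S(1) by (auto simp: valleys_def)
  \<comment> \<open>Abscissa 1 is the valley turned by \<open>Swap\<close>; the turned valleys of
    the tail lie two further to the right.\<close>
  let ?S = "insert 1 (Suc ` Suc ` S)"
  have "?S \<subseteq> valleys (D # U # P)"
    using S(1) pos by (auto simp: Suc_in_valleys_Cons) (auto simp: valleys_def)
  moreover have "Suc -` Suc -` ?S = S" by auto
  then have "turn_valleys (D # U # P) ?S = U # D # turn_valleys P S"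
    using pos by (subst turn_valleys_Swap_vimage) (fastforce simp: numeral_2_eq_2)+
  ultimately show ?case using S by metis
next
  case Last
  have "{1} \<subseteq> valleys [D]" "[U] = turn_valleys [D] {1}"
    by (auto simp: valleys_def turn_valleys_def)
  then show ?case by blast
qed (auto simp: turn_valleys_def)

text \<open>One step is peeled off if abscissa 1 is not in \<open>S\<close>, and otherwise the whole
  first valley, which may take two steps; hence the induction on length.\<close>

lemma turn_turn_valleys:
  "S \<subseteq> valleys P \<Longrightarrow> turn P (turn_valleys P S)"
proof (induction P arbitrary: S rule: length_induct)
  case (1 P)
  have IH: "turn P' (turn_valleys P' S')"
    if "length P' < length P" "S' \<subseteq> valleys P'" for P' S'
    using 1 that by blast
  have zero: "0 \<notin> S" using 1 zero_notin_valleys by blast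
  show ?case
  proof (cases P)
    case Nil
    then show ?thesis by (simp add: turn.Nil)
  next
    case P: (Cons x P')
    show ?thesis
    proof (cases "1 \<in> S")
      case False
      have "Suc -` S \<subseteq> valleys P'"
      proof
        fix i assume "i \<in> Suc -` S"
        with False have "1 \<le> i" "Suc i \<in> valleys (x # P')" using 1 P by (cases i; auto)+
        then show "i \<in> valleys P'" using Suc_in_valleys_Cons by blast
      qed
      then show ?thesis
        using P zero False IH[of P'] by (simp add: turn_valleys_Cons_vimage turn.Cons)
    next
      case True
      then have one: "1 \<in> valleys P" using 1 by blast
      have x: "x = D" using one P by (simp add: valleys_def)
      show ?thesis
      proof (cases P')
        case Nil
        then have "turn_valleys P S = [U]" using P True by (simp add: turn_valleys_Cons)
        then show ?thesis using P Nil x turn.Last by simp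
      next
        case P': (Cons y P'')
        have y: "y = U" using one P P' by (simp add: valleys_def)
        have two: "2 \<notin> S"
          using one 1 valleys_Suc_disjoint[of 1 P] by (auto simp: numeral_2_eq_2)
        have "Suc -` Suc -` S \<subseteq> valleys P''"
        proof
          fix i assume i: "i \<in> Suc -` Suc -` S"
          with two have "1 \<le> i" by (cases i) (auto simp: numeral_2_eq_2)
          moreover have "Suc (Suc i) \<in> valleys (x # y # P'')" using i 1 P P' by auto
          ultimately show "i \<in> valleys P''" using Suc_in_valleys_Cons by simp
        qed
        then have "turn P'' (turn_valleys P'' (Suc -` Suc -` S))"
          using IH[of P''] P P' by simp
        then show ?thesis
          using P P' x y True two turn_valleys_Swap_vimage[of S x y P''] turn.Swap by metis
      qed
    qed
  qed
qed

lemma turn_iff: "turn P Q \<longleftrightarrow> (\<exists>S \<subseteq> valleys P. Q = turn_valleys P S)"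
  using turn_imp_turn_valleys turn_turn_valleys by blast

lemma turn_filling: "turn P (filling P)"
  unfolding filling_def by (rule turn_turn_valleys) simp

lemma turn_weakly_below: "turn P Q \<Longrightarrow> weakly_below P Q"
  by (auto simp: turn_iff weakly_below_def height_turn_valleys)

lemma finite_turn: "finite {Q. turn P Q}"
proof (rule finite_subset)
  show "{Q. turn P Q} \<subseteq> turn_valleys P ` Pow (valleys P)"
    by (auto simp: turn_iff)
  show "finite (turn_valleys P ` Pow (valleys P))"
    by (simp add: valleys_def)
qed

section \<open>The degree in terms of heights\<close>

text \<open>The paths that filling takes to the top path in at most \<open>k\<close> steps, in terms of heights: a
  point of height \<open>h\<close> off the initial run of upsteps delays completion by \<open>length P - 1 - h\<close>.\<close>

definition reach :: "nat \<Rightarrow> path \<Rightarrow> bool" where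
  "reach k P \<longleftrightarrow>
     (\<forall>i \<le> length P. int (length P) - 1 - int k \<le> height P i \<or> height P i = int i)"

lemma reachD: "reach k P \<Longrightarrow> i \<le> length P \<Longrightarrow>
    int (length P) - 1 - int k \<le> height P i \<or> height P i = int i"
  by (simp add: reach_def)

lemma reach_0: "reach 0 P \<longleftrightarrow> P = top_path (length P)"
proof
  assume *: "reach 0 P"
  have below: "height P i = int i" if "i < length P" for i
    using reachD[OF *, of i] that height_le[of P i] by auto
  \<comment> \<open>At the end the bound alone still allows height \<open>length P - 1\<close>. The
    last step starts at exactly that height and changes it, so only \<open>length P\<close>
    remains.\<close>
  have last: "height P (length P) = int (length P)"
  proof (cases P rule: rev_cases)
    case (snoc P' x)
    have "rise x \<noteq> 0" by (cases x) auto
    then show ?thesis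
      using reachD[OF *, of "length P"] below[of "length P'"] height_le[of P "length P"] snoc
        height_beyond[of P' "Suc (length P')"]
      by (cases x) (auto simp: height_append)
  qed simp
  show "P = top_path (length P)"
    by (rule height_eq_id_imp_top) (metis below last le_neq_implies_less)
next
  assume P: "P = top_path (length P)"
  show "reach 0 P"
    unfolding reach_def by (metis P height_top_path)
qed

lemma reach_mono: "reach k P \<Longrightarrow> k \<le> l \<Longrightarrow> reach l P"
  unfolding reach_def by (smt (verit) of_nat_mono)

text \<open>A turned valley at height h has a neighbour at height h + 1, on its left if the valley
  ends the path and on its right otherwise. The neighbour is not turned and keeps its height, so the
  condition for \<open>Q\<close> at the neighbour gives the condition for \<open>P\<close> at the
  valley, weaker by one.\<close>

lemma reach_turn:
  assumes "turn P Q" "reach k Q"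
  shows "reach (Suc k) P"
proof -
  obtain S where S: "S \<subseteq> valleys P" "Q = turn_valleys P S"
    using assms(1) turn_iff by blast
  have len: "length Q = length P" using S by simp
  have hQ: "height Q i = height P i + (if i \<in> S then 2 else 0)" if "i \<le> length P" for i
    using S that by (simp add: height_turn_valleys)
  show ?thesis
    unfolding reach_def
  proof (intro allI impI)
    fix i assume i: "i \<le> length P"
    show "int (length P) - 1 - int (Suc k) \<le> height P i \<or> height P i = int i"
    proof (cases "i \<in> S")
      case False
      then show ?thesis using reachD[OF assms(2), of i] hQ[OF i] i len by auto
    next
      case True
      then have v: "i \<in> valleys P" using S by blast
      then obtain j where j: "i = Suc j" by (cases i) (auto simp: valleys_def)
      have jS: "j \<notin> S" "Suc i \<notin> S"
        using S v j valleys_Suc_disjoint by blast+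
      show ?thesis
      proof (cases "i = length P")
        case True
        have "height P i = height P j - 1"
          using v j i by (auto simp: valleys_def height_Suc)
        then show ?thesis
          using reachD[OF assms(2), of j] hQ[of j] jS i len j True by auto
      next
        case False
        then have "height P (Suc i) = height P i + 1"
          using v i by (auto simp: valleys_def height_Suc)
        then show ?thesis
          using reachD[OF assms(2), of "Suc i"] hQ[of "Suc i"] jS i len False by auto
      qed
    qed
  qed
qed

text \<open>A point that violates the stronger bound after filling was not raised, lies off the
  initial run of upsteps, and has the least height that \<open>reach (Suc k) P\<close> allows there.
  Its neighbours cannot be lower, so it is a valley and was raised after all.\<close>

lemma reach_filling:
  assumes "reach (Suc k) P"
  shows "reach k (filling P)"
  unfolding reach_def
proof (intro allI impI)
  fix i assume "i \<le> length (filling P)"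
  then have i: "i \<le> length P" by simp
  have h: "height (filling P) i = height P i + (if i \<in> valleys P then 2 else 0)"
    unfolding filling_def using i by (simp add: height_turn_valleys)
  show "int (length (filling P)) - 1 - int k \<le> height (filling P) i
      \<or> height (filling P) i = int i"
  proof (rule ccontr)
    assume neg: "\<not> ?thesis"
    then have ni: "i \<notin> valleys P" "height P i \<noteq> int i"
      and hi: "height P i = int (length P) - 2 - int k"
      using h reachD[OF assms i] height_le[of "filling P" i] by (auto split: if_splits)
    obtain j where j: "i = Suc j" using ni by (cases i) auto
    have "P ! j = D"
      using reachD[OF assms, of j] height_Suc[of j P] i j ni hi by (cases "P ! j") auto
    moreover have U: "P ! i = U" if "i < length P"
      using reachD[OF assms, of "Suc i"] height_Suc[of i P] height_le[of P i] that ni hi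
      by (cases "P ! i") auto
    moreover have "i = length P \<or> P ! i = U"
      using U i le_neq_implies_less by blast
    ultimately have "i \<in> valleys P"
      using i j by (simp add: valleys_def)
    then show False using ni by blast
  qed
qed

lemma filling_funpow_eq_top_iff:
  "(filling ^^ k) P = top_path (length P) \<longleftrightarrow> reach k P"
proof (induction k arbitrary: P)
  case 0
  then show ?case by (simp add: reach_0)
next
  case (Suc k)
  have "(filling ^^ Suc k) P = top_path (length P) \<longleftrightarrow> reach k (filling P)"
    using Suc[of "filling P"] by (simp add: funpow_Suc_right del: funpow.simps)
  also have "\<dots> \<longleftrightarrow> reach (Suc k) P"
    using reach_filling reach_turn turn_filling by blast
  finally show ?case .
qed

lemma degree_eq_Least: "degree P = (LEAST k. reach k P)"
  by (simp add: degree_def filling_funpow_eq_top_iff)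

lemma degree_le_iff: "degree P \<le> k \<longleftrightarrow> reach k P"
proof
  assume "reach k P"
  then show "degree P \<le> k" by (simp add: degree_eq_Least Least_le)
next
  assume k: "degree P \<le> k"
  \<comment> \<open>No height is below \<open>- length P\<close>, so this many steps suffice. Some
    such number is all that is needed for the least one to be attained.\<close>
  have "reach (length P + length P) P"
    unfolding reach_def
  proof (intro allI impI disjI1)
    have "- int i \<le> height P i" for i
    proof (induction P arbitrary: i)
      case (Cons x P)
      have "- 1 \<le> rise x" by (cases x) auto
      then show ?case using Cons[of "i - 1"] by (cases i) auto
    qed simp
    then show "int (length P) - 1 - int (length P + length P) \<le> height P i"
      if "i \<le> length P" for i
      using that by (smt (verit) of_nat_add of_nat_mono)
  qed
  then have "reach (degree P) P"
    unfolding degree_eq_Least by (rule LeastI)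
  then show "reach k P" using k reach_mono by blast
qed

lemma degree_turn: "turn P Q \<Longrightarrow> degree P \<le> Suc (degree Q)"
  using reach_turn degree_le_iff by blast

section \<open>Counting chains whose number of steps is independent of the degree\<close>

fun walks :: "nat \<Rightarrow> path \<Rightarrow> nat" where
  "walks 0 P = (if P = top_path (length P) then 1 else 0)"
| "walks (Suc k) P = (\<Sum>Q \<in> {Q. turn P Q}. walks k Q)"

lemma small_interval_chain_Cons:
  "small_interval_chain (P # Q # Ps) \<longleftrightarrow> turn P Q \<and> small_interval_chain (Q # Ps)"
proof
  assume *: "small_interval_chain (P # Q # Ps)"
  have "turn P Q"
    using *[unfolded small_interval_chain_def, rule_format, of 0] by (auto simp: turn_iff)
  moreover have "small_interval_chain (Q # Ps)"
    unfolding small_interval_chain_def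
    using *[unfolded small_interval_chain_def, rule_format, of "Suc i" for i] by simp
  ultimately show "turn P Q \<and> small_interval_chain (Q # Ps)" ..
next
  assume *: "turn P Q \<and> small_interval_chain (Q # Ps)"
  show "small_interval_chain (P # Q # Ps)"
    unfolding small_interval_chain_def
  proof (intro allI impI)
    fix i assume "Suc i < length (P # Q # Ps)"
    then show "weakly_below ((P # Q # Ps) ! i) ((P # Q # Ps) ! Suc i) \<and>
        (\<exists>S \<subseteq> valleys ((P # Q # Ps) ! i).
          (P # Q # Ps) ! Suc i = turn_valleys ((P # Q # Ps) ! i) S)"
      using * turn_weakly_below[of P Q]
      by (cases i) (auto simp: turn_iff small_interval_chain_def)
  qed
qed

definition chains :: "nat \<Rightarrow> path \<Rightarrow> path list set" where
  "chains k P = {Ps. length Ps = Suc k \<and> hd Ps = P \<and>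
     last Ps = top_path (length P) \<and> small_interval_chain Ps}"

lemma chains_0: "chains 0 P = (if P = top_path (length P) then {[P]} else {})"
proof (intro set_eqI iffI)
  fix Ps assume Ps: "Ps \<in> chains 0 P"
  then have "length Ps = Suc 0" by (simp add: chains_def)
  then obtain Q where Q: "Ps = [Q]" by (auto simp: length_Suc_conv)
  have "hd Ps = P" "last Ps = top_path (length P)" using Ps unfolding chains_def by blast+
  then show "Ps \<in> (if P = top_path (length P) then {[P]} else {})"
    unfolding Q by (metis last.simps list.sel(1) singletonI)
next
  fix Ps assume "Ps \<in> (if P = top_path (length P) then {[P]} else {})"
  then have Ps: "Ps = [P]" "P = top_path (length P)" by (metis empty_iff singletonD)+
  then show "Ps \<in> chains 0 P"
    unfolding chains_def Ps(1) by (simp add: small_interval_chain_def)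
qed

lemma chains_Suc: "chains (Suc k) P = (\<Union>Q \<in> {Q. turn P Q}. (#) P ` chains k Q)"
proof (intro set_eqI iffI)
  fix Ps assume "Ps \<in> chains (Suc k) P"
  then obtain Q Qs where Ps: "Ps = P # Q # Qs" "Ps \<in> chains (Suc k) P"
    by (auto simp: chains_def length_Suc_conv)
  then have "turn P Q" "Q # Qs \<in> chains k Q"
    by (auto simp: chains_def small_interval_chain_Cons turn_length)
  then show "Ps \<in> (\<Union>Q \<in> {Q. turn P Q}. (#) P ` chains k Q)"
    using Ps by blast
next
  fix Ps assume "Ps \<in> (\<Union>Q \<in> {Q. turn P Q}. (#) P ` chains k Q)"
  then obtain Q Qs where *: "turn P Q" "Qs \<in> chains k Q" "Ps = P # Qs" by auto
  then obtain Qs' where "Qs = Q # Qs'" by (auto simp: chains_def length_Suc_conv)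
  then show "Ps \<in> chains (Suc k) P"
    using * turn_length[of P Q] by (auto simp: chains_def small_interval_chain_Cons)
qed

lemma card_chains: "finite (chains k P) \<and> card (chains k P) = walks k P"
proof (induction k arbitrary: P)
  case 0
  then show ?case by (simp add: chains_0)
next
  case (Suc k)
  have disj: "(#) P ` chains k Q \<inter> (#) P ` chains k Q' = {}" if "Q \<noteq> Q'" for Q Q'
    using that by (auto simp: chains_def)
  have "card (chains (Suc k) P) = (\<Sum>Q \<in> {Q. turn P Q}. card ((#) P ` chains k Q))"
    unfolding chains_Suc using Suc disj finite_turn by (intro card_UN_disjoint) auto
  also have "\<dots> = walks (Suc k) P"
    using Suc by (simp add: card_image)
  finally show ?case
    using Suc finite_turn by (simp add: chains_Suc)
qed

lemma num_chains_eq_walks: "num_chains P = walks (degree P) P"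
  using card_chains[of "degree P" P] by (simp add: num_chains_def chains_def)

text \<open>By \<open>degree_turn\<close> a step lowers the degree by at most one, so the top path,
  of degree 0, is out of range.\<close>

lemma walks_eq_0: "k < degree P \<Longrightarrow> walks k P = 0"
proof (induction k arbitrary: P)
  case 0
  then show ?case using degree_le_iff[of P 0] reach_0 by auto
next
  case (Suc k)
  then have "walks k Q = 0" if "turn P Q" for Q
    using degree_turn[OF that] by (intro Suc.IH) simp
  then show ?case by simp
qed

section \<open>First steps of chains of minimal length\<close>

definition fast_turns :: "path \<Rightarrow> path set" where
  "fast_turns P = {Q. turn P Q \<and> degree Q < degree P}"

text \<open>A first step that does not lower the degree leaves too few steps and contributes no
  walks. One that does lowers it by exactly one, so the remaining walks are again chains of minimal
  length.\<close>

lemma num_chains_rec: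
  assumes "0 < degree P"
  shows "num_chains P = (\<Sum>Q \<in> fast_turns P. num_chains Q)"
proof -
  obtain k where k: "degree P = Suc k" using assms gr0_conv_Suc by blast
  have "num_chains P = (\<Sum>Q \<in> {Q. turn P Q}. walks k Q)"
    by (simp add: num_chains_eq_walks k)
  also have "\<dots> = (\<Sum>Q \<in> fast_turns P. walks k Q)"
  proof (rule sum.mono_neutral_right)
    show "\<forall>Q \<in> {Q. turn P Q} - fast_turns P. walks k Q = 0"
      by (auto simp: fast_turns_def k intro!: walks_eq_0)
  qed (auto simp: fast_turns_def finite_turn)
  also have "\<dots> = (\<Sum>Q \<in> fast_turns P. num_chains Q)"
  proof (rule sum.cong)
    fix Q assume "Q \<in> fast_turns P"
    then have "degree Q = k" using degree_turn[of P Q] k by (auto simp: fast_turns_def)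
    then show "walks k Q = num_chains Q" by (simp add: num_chains_eq_walks)
  qed simp
  finally show ?thesis .
qed

section \<open>Initial upsteps\<close>

lemma turn_U_Cons: "turn (U # P) Q \<longleftrightarrow> (\<exists>Q'. Q = U # Q' \<and> turn P Q')"
  by (auto elim: turn.cases intro: turn.intros)

lemma top_path_Suc: "top_path (Suc n) = U # top_path n"
  by (simp add: top_path_def)

text \<open>Abscissa 1 is never a valley of \<open>U # P\<close>, so prepending \<open>U\<close> is
  a bijection from the turns of \<open>P\<close> to those of \<open>U # P\<close>.\<close>

lemma walks_U_Cons: "walks k (U # P) = walks k P"
proof (induction k arbitrary: P)
  case 0
  then show ?case by (simp add: top_path_Suc)
next
  case (Suc k)
  have "{Q. turn (U # P) Q} = (#) U ` {Q. turn P Q}"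
    by (auto simp: turn_U_Cons)
  then show ?case by (simp add: sum.reindex Suc)
qed

text \<open>The length and all heights grow by one, so the condition in \<open>reach\<close> is
  merely shifted; the additional point is the origin, where \<open>height P i = int i\<close>
  holds.\<close>

lemma degree_U_Cons: "degree (U # P) = degree P"
proof -
  have "reach k (U # P) \<longleftrightarrow> reach k P" for k
  proof
    assume *: "reach k (U # P)"
    show "reach k P"
      unfolding reach_def using reachD[OF *, of "Suc i" for i] by fastforce
  next
    assume *: "reach k P"
    show "reach k (U # P)"
      unfolding reach_def
    proof (intro allI impI)
      fix i assume "i \<le> length (U # P)"
      then show "int (length (U # P)) - 1 - int k \<le> height (U # P) i \<or> height (U # P) i = int i"
        using reachD[OF *, of "i - 1"] by (cases i) auto
    qed
  qed
  then show ?thesis by (simp add: degree_eq_Least)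
qed

lemma num_chains_U_Cons: "num_chains (U # P) = num_chains P"
  by (simp add: num_chains_eq_walks degree_U_Cons walks_U_Cons)

section \<open>Degree and fast turns when the junction is a minimum\<close>

definition ends_low :: "path \<Rightarrow> bool" where
  "ends_low P \<longleftrightarrow> (\<forall>i. height P (length P) \<le> height P i)"

text \<open>Here and in \<open>ends_low\<close> the abscissa is unbounded: \<open>height P\<close>
  is constant beyond the end of \<open>P\<close>, so this says the same as the bounded form.\<close>

definition stays_nonneg :: "path \<Rightarrow> bool" where
  "stays_nonneg P \<longleftrightarrow> (\<forall>i. 0 \<le> height P i)"

text \<open>The junction is a lowest point of \<open>A @ B\<close>. Its abscissa is positive and its
  height at most 0, so it lies off the initial run of upsteps, and \<open>reach k\<close> is decided
  there alone.\<close>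

lemma degree_append:
  assumes A: "A \<noteq> []" "ends_low A" and B: "stays_nonneg B"
  shows "int (degree (A @ B)) = int (length (A @ B)) - 1 - height A (length A)"
proof -
  let ?h = "height A (length A)"
  have h0: "?h \<le> 0" using A(2) by (metis ends_low_def height_0)
  have at: "height (A @ B) (length A) = ?h" by (simp add: height_append)
  have ge: "?h \<le> height (A @ B) i" for i
    using A(2) B unfolding ends_low_def stays_nonneg_def height_append
    by (smt (verit))
  have reach: "reach k (A @ B) \<longleftrightarrow> int (length (A @ B)) - 1 - int k \<le> ?h" for k
  proof
    assume "reach k (A @ B)"
    then show "int (length (A @ B)) - 1 - int k \<le> ?h"
      using reachD[of k "A @ B" "length A"] at h0 A(1) by auto
  next
    assume "int (length (A @ B)) - 1 - int k \<le> ?h"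
    then show "reach k (A @ B)"
      unfolding reach_def using ge order_trans by blast
  qed
  let ?d = "nat (int (length (A @ B)) - 1 - ?h)"
  have "0 < length (A @ B)" using A(1) by simp
  then have d: "int ?d = int (length (A @ B)) - 1 - ?h" using h0 by linarith
  have "degree (A @ B) \<le> ?d" unfolding degree_le_iff reach d by linarith
  moreover have "int (length (A @ B)) - 1 - int (degree (A @ B)) \<le> ?h"
    using reach[of "degree (A @ B)"] by (simp only: degree_le_iff[symmetric] order_refl)
  ultimately show ?thesis using d by linarith
qed

text \<open>The degree is governed by the minimal height, so it drops exactly when all points of
  that height are raised.\<close>

lemma fast_turns_append:
  assumes A: "ends_low A" "A = D # A'" and B: "stays_nonneg B"
  shows "fast_turns (A @ B) =
    {Q. turn (A @ B) Q \<and> (\<forall>i \<le> length Q. height A (length A) < height Q i)}"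
    and "0 < degree (A @ B)"
proof -
  let ?h = "height A (length A)"
  have "?h \<le> height A 1" using A(1) ends_low_def by blast
  then have h: "?h \<le> -1" using A(2) by simp
  have deg: "int (degree (A @ B)) = int (length (A @ B)) - 1 - ?h"
    using degree_append A B by blast
  moreover have "0 < length (A @ B)" using A(2) by simp
  ultimately show pos: "0 < degree (A @ B)" using h by linarith
  have "degree Q < degree (A @ B) \<longleftrightarrow> (\<forall>i \<le> length Q. ?h < height Q i)"
    if "turn (A @ B) Q" for Q
  proof -
    have "degree Q < degree (A @ B) \<longleftrightarrow> reach (degree (A @ B) - 1) Q"
      using pos by (auto simp: degree_le_iff[symmetric])
    moreover have "int (length Q) - 1 - int (degree (A @ B) - 1) = ?h + 1"
      using deg pos turn_length[OF that] by (simp add: of_nat_diff)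
    \<comment> \<open>Since \<open>?h + 1 \<le> 0\<close>, the alternative
      \<open>height Q i = int i\<close> in \<open>reach\<close> already implies the bound.\<close>
    ultimately show ?thesis
      using h unfolding reach_def by (smt (verit) of_nat_0_le_iff)
  qed
  then show "fast_turns (A @ B) = {Q. turn (A @ B) Q \<and> (\<forall>i \<le> length Q. ?h < height Q i)}"
    by (auto simp: fast_turns_def)
qed


section \<open>Splitting turns at the junction\<close>

lemma turn_Nil_iff: "turn [] Q \<longleftrightarrow> Q = []"
  by (auto elim: turn.cases intro: turn.intros)

lemma turn_Cons_iff:
  "turn (x # P) Q \<longleftrightarrow> (\<exists>Q'. Q = x # Q' \<and> turn P Q') \<or>
     (\<exists>P' Q'. x = D \<and> P = U # P' \<and> Q = U # D # Q' \<and> turn P' Q') \<or>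
     x = D \<and> P = [] \<and> Q = [U]"
  by (subst turn.simps) auto

text \<open>The valley turned at the junction uses up the steps on both of its sides, so the parts
  before and after it turn independently; to the left part it looks like a valley at the end.
  Peeling the front removes one or two steps, hence the induction on length.\<close>

lemma turn_append_iff:
  "length Q = length P \<Longrightarrow>
     turn (P @ D # U # P') (Q @ U # D # Q') \<longleftrightarrow> turn (P @ [D]) (Q @ [U]) \<and> turn P' Q'"
proof (induction P arbitrary: Q rule: length_induct)
  case (1 P)
  have IH: "turn (R @ D # U # P') (S @ U # D # Q') \<longleftrightarrow> turn (R @ [D]) (S @ [U]) \<and> turn P' Q'"
    if "length R < length P" "length S = length R" for R S
    using 1 that by blast
  show ?case
  proof (cases P)
    case Nil
    then show ?thesis using 1 by (auto simp: turn_Cons_iff)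
  next
    case P: (Cons x P1)
    then obtain y Q1 where Q: "Q = y # Q1" "length Q1 = length P1"
      using 1 by (cases Q) auto
    have IH1: "turn (P1 @ D # U # P') (Q1 @ U # D # Q') \<longleftrightarrow>
        turn (P1 @ [D]) (Q1 @ [U]) \<and> turn P' Q'"
      using IH P Q by simp
    show ?thesis
    proof (cases P1)
      case Nil
      then show ?thesis using P Q IH1 by (auto simp: turn_Cons_iff[of x])
    next
      case P1: (Cons x' P2)
      then obtain y' Q2 where Q1: "Q1 = y' # Q2" "length Q2 = length P2"
        using Q by (cases Q1) auto
      have "turn (P2 @ D # U # P') (Q2 @ U # D # Q') \<longleftrightarrow>
          turn (P2 @ [D]) (Q2 @ [U]) \<and> turn P' Q'"
        using IH P P1 Q1 by simp
      then show ?thesis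
        using P Q P1 Q1 IH1 by (auto simp: turn_Cons_iff[of x])
    qed
  qed
qed

text \<open>Turning changes heights by 0 or 2. If d is the change one step before the end, then the
  change at the end is d + 2, so d = 0.\<close>

lemma turn_snoc_height:
  assumes "turn (P @ [D]) (Q @ [U])"
  shows "height Q (length Q) = height P (length P)"
proof -
  obtain S where S: "S \<subseteq> valleys (P @ [D])" "Q @ [U] = turn_valleys (P @ [D]) S"
    using assms turn_iff by blast
  have len: "length Q = length P" using turn_length[OF assms] by simp
  have "height (Q @ [U]) i - height (P @ [D]) i \<in> {0, 2}" if "i \<le> Suc (length P)" for i
    using S that by (simp add: height_turn_valleys)
  from this[of "length P"] this[of "Suc (length P)"] show ?thesis
    using len height_beyond[of P "Suc (length P)"] height_beyond[of Q "Suc (length P)"]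
    by (auto simp: height_append)
qed

lemma ends_low_last: "ends_low P \<Longrightarrow> P \<noteq> [] \<Longrightarrow> \<exists>P'. P = P' @ [D]"
proof (cases P rule: rev_cases)
  case (snoc P' x)
  assume "ends_low P"
  then have "height P (length P) \<le> height P (length P')" by (simp add: ends_low_def)
  then have "x = D"
    using snoc height_beyond[of P' "Suc (length P')"] by (cases x) (auto simp: height_append)
  then show ?thesis using snoc by blast
qed simp

text \<open>The junction has minimal height h, so it must be raised to h + 2, which fixes the step
  before it as \<open>U\<close> and the step after it, if any, as \<open>D\<close>. Both neighbours
  have height h + 1, and no point of \<open>Q\<close> is lower: the left part therefore ends low,
  and the right part, measured from its start, stays nonnegative.\<close>

lemma fast_turns_append_split:
  assumes A: "ends_low A" "A = D # A'" and B: "stays_nonneg B"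
    and Q: "Q \<in> fast_turns (A @ B)"
  obtains Q\<^sub>1 Q\<^sub>2 where "Q = Q\<^sub>1 @ U # Q\<^sub>2" "Suc (length Q\<^sub>1) = length A" "ends_low Q\<^sub>1"
    "\<And>B'. B = U # B' \<Longrightarrow> \<exists>R. Q\<^sub>2 = D # R \<and> stays_nonneg R"
proof -
  let ?m = "length A"
  let ?h = "height A ?m"
  have turn: "turn (A @ B) Q" and above: "?h < height Q i" if "i \<le> length Q" for i
    using Q that by (auto simp: fast_turns_append(1)[OF A B])
  have turn: "turn (A @ B) Q" using turn by blast
  obtain S where S: "S \<subseteq> valleys (A @ B)" "Q = turn_valleys (A @ B) S"
    using turn turn_iff by blast
  have len: "length Q = length A + length B" using turn_length[OF turn] by simp
  have "height Q ?m = ?h + (if ?m \<in> S then 2 else 0)"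
    using S by (simp add: height_turn_valleys height_append)
  moreover have "?h < height Q ?m" using above len by simp
  ultimately have mS: "?m \<in> S" and hm: "height Q ?m = ?h + 2" by (auto split: if_splits)
  define Q\<^sub>1 where "Q\<^sub>1 = take (length A') Q"
  define Q\<^sub>2 where "Q\<^sub>2 = drop ?m Q"
  have l: "length A' < length Q" using len A(2) by simp
  have "Q ! length A' = U" using S mS A(2) by (simp add: nth_turn_valleys)
  then have QQ: "Q = Q\<^sub>1 @ U # Q\<^sub>2"
    unfolding Q\<^sub>1_def Q\<^sub>2_def using id_take_nth_drop[OF l] A(2) by simp
  have len1: "Suc (length Q\<^sub>1) = ?m" using l A(2) by (simp add: Q\<^sub>1_def)
  have h1: "height Q\<^sub>1 (length Q\<^sub>1) = ?h + 1"
  proof -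
    have "height Q (Suc (length Q\<^sub>1)) = height Q\<^sub>1 (length Q\<^sub>1) + 1"
      using height_beyond[of Q\<^sub>1 "Suc (length Q\<^sub>1)"] by (simp add: QQ height_append)
    then show ?thesis using hm len1 by simp
  qed
  have "ends_low Q\<^sub>1"
    unfolding ends_low_def h1
  proof
    fix i
    show "?h + 1 \<le> height Q\<^sub>1 i"
    proof (cases "i \<le> length Q\<^sub>1")
      case True
      then have "height Q i = height Q\<^sub>1 i" by (simp add: QQ height_append)
      then show ?thesis using above[of i] True QQ by simp
    next
      case False
      then show ?thesis using h1 height_beyond[of Q\<^sub>1 i] by simp
    qed
  qed
  moreover have "\<exists>R. Q\<^sub>2 = D # R \<and> stays_nonneg R" if "B = U # B'" for B'
  proof -
    have "Suc ?m \<notin> S" using S mS valleys_Suc_disjoint by blast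
    then have "Q ! ?m = D" using S mS that by (simp add: nth_turn_valleys)
    moreover have "Q ! Suc (length Q\<^sub>1) = Q\<^sub>2 ! 0" by (simp add: QQ nth_append)
    moreover have "Q\<^sub>2 \<noteq> []" using len that by (simp add: Q\<^sub>2_def)
    ultimately obtain R where R: "Q\<^sub>2 = D # R"
      using len1 by (cases Q\<^sub>2) auto
    have "0 \<le> height R i" for i
    proof (cases "i \<le> length R")
      case True
      have "height Q (Suc (Suc (length Q\<^sub>1)) + i) = ?h + 1 + height R i"
        using h1 height_beyond[of Q\<^sub>1 "Suc (Suc (length Q\<^sub>1)) + i"]
        by (simp add: QQ R height_append)
      then show ?thesis using above[of "Suc (Suc (length Q\<^sub>1)) + i"] True QQ R by simp
    next
      case False
      have "height Q (length Q) = ?h + 1 + height R (length R)"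
        using h1 height_beyond[of Q\<^sub>1 "length Q"]
        by (simp add: QQ R height_append)
      then show ?thesis using above[of "length Q"] False height_beyond[of R i] by simp
    qed
    then show ?thesis using R by (simp add: stays_nonneg_def)
  qed
  ultimately show thesis using that QQ len1 by blast
qed

text \<open>The upstep that comes from turning the last valley of \<open>A\<close> is split off,
  because it becomes the first half of the peak at the junction.\<close>

definition left_turns :: "path \<Rightarrow> path set" where
  "left_turns A = {Q. turn A (Q @ [U]) \<and> ends_low Q}"

definition right_turns :: "path \<Rightarrow> path set" where
  "right_turns B = {R. turn B R \<and> stays_nonneg R}"

lemma stays_nonneg_UD: "stays_nonneg R \<Longrightarrow> stays_nonneg (U # D # R)"
  unfolding stays_nonneg_def
proof
  fix i assume "\<forall>i. 0 \<le> height R i"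
  then show "0 \<le> height (U # D # R) i"
    by (cases i; cases "i - 1") auto
qed

lemma stays_nonneg_U: "stays_nonneg [U]"
  unfolding stays_nonneg_def
proof
  fix i show "0 \<le> height [U] i" by (cases i) auto
qed

lemma stays_nonneg_Nil: "stays_nonneg []"
  by (simp add: stays_nonneg_def)

lemma left_turns_above:
  assumes A: "ends_low A" "A \<noteq> []" and Q: "Q \<in> left_turns A" and R: "stays_nonneg R"
  shows "Suc (length Q) = length A"
    and "height Q (length Q) = height A (length A) + 1"
    and "height A (length A) < height (Q @ R) i"
proof -
  obtain A\<^sub>0 where A\<^sub>0: "A = A\<^sub>0 @ [D]" using ends_low_last[OF A] by blast
  show "Suc (length Q) = length A"
    using Q turn_length unfolding left_turns_def by fastforce
  show h: "height Q (length Q) = height A (length A) + 1"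
    using Q turn_snoc_height[of A\<^sub>0 Q] height_beyond[of A\<^sub>0 "Suc (length A\<^sub>0)"]
    by (simp add: left_turns_def A\<^sub>0 height_append)
  have "height Q (length Q) \<le> height Q i" using Q by (simp add: left_turns_def ends_low_def)
  moreover have "0 \<le> height R (i - length Q)" using R by (simp add: stays_nonneg_def)
  ultimately show "height A (length A) < height (Q @ R) i"
    using h unfolding height_append by linarith
qed

text \<open>The requirement that every point lie above the old minimum also splits at the new peak:
  it becomes \<open>ends_low Q\<close> on the left and \<open>stays_nonneg R\<close> on the
  right.\<close>

lemma fast_turns_append_U:
  assumes A: "ends_low A" "A = D # A'" and B: "stays_nonneg (U # B')"
  shows "fast_turns (A @ U # B') = (\<lambda>(Q, R). Q @ U # D # R) ` (left_turns A \<times> right_turns B')"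
proof -
  obtain A\<^sub>0 where A\<^sub>0: "A = A\<^sub>0 @ [D]" using ends_low_last A by blast
  have split: "turn (A @ U # B') (Q @ U # D # R) \<longleftrightarrow> turn A (Q @ [U]) \<and> turn B' R"
    if "Suc (length Q) = length A" for Q R
    using turn_append_iff[of Q A\<^sub>0 B' R] that by (simp add: A\<^sub>0)
  show ?thesis
  proof (intro set_eqI iffI)
    fix X assume X: "X \<in> fast_turns (A @ U # B')"
    obtain Q Q\<^sub>2 where Q: "X = Q @ U # Q\<^sub>2" "Suc (length Q) = length A" "ends_low Q"
      and "\<exists>R. Q\<^sub>2 = D # R \<and> stays_nonneg R"
      using fast_turns_append_split[OF A B X] by metis
    then obtain R where R: "X = Q @ U # D # R" "stays_nonneg R" by auto
    have "turn (A @ U # B') X" using X by (simp add: fast_turns_def)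
    then have "Q \<in> left_turns A" "R \<in> right_turns B'"
      using split[OF Q(2), of R] Q R by (simp_all add: left_turns_def right_turns_def)
    then show "X \<in> (\<lambda>(Q, R). Q @ U # D # R) ` (left_turns A \<times> right_turns B')"
      using R by force
  next
    fix X assume "X \<in> (\<lambda>(Q, R). Q @ U # D # R) ` (left_turns A \<times> right_turns B')"
    then obtain Q R where X: "X = Q @ U # D # R" and Q: "Q \<in> left_turns A"
      and R: "R \<in> right_turns B'" by auto
    have A': "A \<noteq> []" using A by simp
    have nn: "stays_nonneg (U # D # R)"
      using R stays_nonneg_UD by (simp add: right_turns_def)
    note above = left_turns_above[OF A(1) A' Q nn]
    have "turn (A @ U # B') X"
      using split[OF above(1), of R] X Q R by (simp add: left_turns_def right_turns_def)
    then show "X \<in> fast_turns (A @ U # B')"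
      unfolding fast_turns_append(1)[OF A B] using above(3) X by simp
  qed
qed

text \<open>The same analysis with nothing to the right of the junction: the raised minimum is the
  end of the path.\<close>

lemma fast_turns_ends_low:
  assumes A: "ends_low A" "A = D # A'"
  shows "fast_turns A = (\<lambda>Q. Q @ [U]) ` left_turns A"
proof (intro set_eqI iffI)
  fix X assume X: "X \<in> fast_turns A"
  then have X': "X \<in> fast_turns (A @ [])" by simp
  obtain Q Q\<^sub>2 where Q: "X = Q @ U # Q\<^sub>2" "Suc (length Q) = length A" "ends_low Q"
    using fast_turns_append_split[OF A stays_nonneg_Nil X'] by metis
  have "turn A X" using X by (simp add: fast_turns_def)
  then have "length X = length A" by (rule turn_length)
  moreover have "length X = Suc (length Q) + length Q\<^sub>2" using Q by simp
  ultimately have "length Q\<^sub>2 = 0" using Q(2) by linarith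
  then have "Q\<^sub>2 = []" by simp
  then show "X \<in> (\<lambda>Q. Q @ [U]) ` left_turns A"
    using Q \<open>turn A X\<close> by (simp add: left_turns_def)
next
  fix X assume "X \<in> (\<lambda>Q. Q @ [U]) ` left_turns A"
  then obtain Q where X: "X = Q @ [U]" and Q: "Q \<in> left_turns A" by auto
  have A': "A \<noteq> []" using A by simp
  note above = left_turns_above[OF A(1) A' Q stays_nonneg_U]
  show "X \<in> fast_turns A"
    using fast_turns_append(1)[OF A stays_nonneg_Nil] X Q above(3)
    by (simp add: left_turns_def)
qed

section \<open>Short left factors\<close>

lemma ends_low_D: "ends_low [D]"
  unfolding ends_low_def
proof
  fix i show "height [D] (length [D]) \<le> height [D] i" by (cases i) auto
qed

lemma ends_low_DUD: "ends_low [D, U, D]"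
  unfolding ends_low_def
proof
  fix i show "height [D, U, D] (length [D, U, D]) \<le> height [D, U, D] i"
    by (cases i; cases "i - 1"; cases "i - 2") auto
qed

lemma ends_low_Nil: "ends_low []"
  by (simp add: ends_low_def)

lemma left_turns_D: "left_turns [D] = {[]}"
  by (auto simp: left_turns_def turn_Cons_iff turn_Nil_iff ends_low_Nil)

lemma num_chains_Nil: "num_chains [] = 1"
proof -
  have "degree [] = 0" using degree_le_iff[of "[]" 0] by (simp add: reach_def)
  then show ?thesis by (simp add: num_chains_eq_walks top_path_def)
qed

lemma num_chains_D: "num_chains [D] = 1"
proof -
  have "fast_turns [D] = {[U]}"
    using fast_turns_ends_low[OF ends_low_D] by (simp add: left_turns_D)
  moreover have "0 < degree [D]"
    using fast_turns_append(2)[OF ends_low_D refl stays_nonneg_Nil] by simp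
  ultimately show ?thesis by (simp add: num_chains_rec[of "[D]"] num_chains_U_Cons num_chains_Nil)
qed

text \<open>With \<open>[D]\<close> as left factor the only left turn is empty, and the initial
  upstep of \<open>U # D # R\<close> does not affect the count.\<close>

lemma num_chains_D_U:
  assumes "stays_nonneg (U # B)"
  shows "num_chains (D # U # B) = (\<Sum>R \<in> right_turns B. num_chains (D # R))"
proof -
  have "(\<lambda>(Q, R). Q @ U # D # R) ` ({[]} \<times> right_turns B) = (\<lambda>R. U # D # R) ` right_turns B"
    by (auto simp: image_def)
  then have "fast_turns (D # U # B) = (\<lambda>R. U # D # R) ` right_turns B"
    using fast_turns_append_U[OF ends_low_D refl assms] by (simp add: left_turns_D)
  moreover have "0 < degree (D # U # B)"
    using fast_turns_append(2)[OF ends_low_D refl assms] by simp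
  ultimately show ?thesis
    by (simp add: num_chains_rec[of "D # U # B"] sum.reindex inj_on_def num_chains_U_Cons)
qed

lemma num_chains_DU: "num_chains [D, U] = 1"
proof -
  have "right_turns [] = {[]}"
    by (auto simp: right_turns_def turn_Nil_iff stays_nonneg_Nil)
  then show ?thesis using num_chains_D_U[OF stays_nonneg_U] by (simp add: num_chains_D)
qed

text \<open>The final \<open>D\<close> must be turned along with the first valley, since it ends at
  the same minimal height. In the induction for the product formula, the value 1 makes this factor
  disappear.\<close>

lemma num_chains_DUD: "num_chains [D, U, D] = 1"
proof -
  have "\<not> stays_nonneg [D]"
  proof
    assume "stays_nonneg [D]"
    then have "0 \<le> height [D] (Suc 0)" unfolding stays_nonneg_def ..
    then show False by simp
  qed
  then have "right_turns [D] = {[U]}"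
    by (auto simp: right_turns_def turn_Nil_iff turn_Cons_iff stays_nonneg_U)
  then show ?thesis
    using num_chains_D_U[OF stays_nonneg_UD[OF stays_nonneg_Nil]] by (simp add: num_chains_DU)
qed

section \<open>The product formula\<close>

lemma num_chains_append:
  assumes "A \<noteq> []" "ends_low A" "stays_nonneg B"
  shows "num_chains (A @ B) = num_chains A * num_chains (D # B)"
  using assms
  \<comment> \<open>Twice the length is counted so that passing to \<open>[D, U, D] @ R\<close> decreases the measure too.\<close>
proof (induction "nat (2 * int (length A + length B) - height A (length A))"
    arbitrary: A B rule: less_induct)
  case less
  have IH: "num_chains (A' @ B') = num_chains A' * num_chains (D # B')"
    if "A' \<noteq> []" "ends_low A'" "stays_nonneg B'"
      "2 * int (length A' + length B') - height A' (length A')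
        < 2 * int (length A + length B) - height A (length A)"
      "0 < 2 * int (length A + length B) - height A (length A)" for A' B'
    using less.hyps[of A' B'] that by simp
  have le_0: "height A (length A) \<le> 0"
    using less.prems(2) by (metis ends_low_def height_0)
  have pos: "0 < 2 * int (length A + length B) - height A (length A)"
    using le_0 less.prems(1) by (cases A) auto
  obtain x A' where A: "A = x # A'" using less.prems(1) by (cases A) auto
  show ?case
  proof (cases x)
    case U
    \<comment> \<open>Dropping the initial upstep lowers the doubled length by 2 and the final
      height by 1, so the measure drops by 1.\<close>
    have ne: "A' \<noteq> []" using le_0 A U by auto
    have "height A' (length A') \<le> height A' i" for i
      using less.prems(2)[unfolded ends_low_def, rule_format, of "Suc i"] A U by simp
    then have "num_chains (A' @ B) = num_chains A' * num_chains (D # B)"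
      using IH[of A' B] ne less.prems(3) pos A U by (simp add: ends_low_def)
    then show ?thesis by (simp add: A U num_chains_U_Cons)
  next
    case D
    note A = A[unfolded D]
    show ?thesis
    proof (cases B)
      case Nil
      then show ?thesis by (simp add: num_chains_D)
    next
      case B: (Cons y B')
      have "y = U"
        using less.prems(3)[unfolded stays_nonneg_def, rule_format, of "Suc 0"] B
        by (cases y) auto
      note B = B[unfolded this]
      have nnB: "stays_nonneg (U # B')" using less.prems(3) B by simp
      show ?thesis
      \<comment> \<open>For \<open>A = [D]\<close> the claim follows from
        \<open>num_chains [D] = 1\<close>. In the other case every left turn \<open>Q\<close> is
        nonempty, as the induction hypothesis requires.\<close>
      proof (cases A')
        case Nil
        then show ?thesis using A by (simp add: num_chains_D)
      next
        case A': (Cons z A'')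
        \<comment> \<open>The measure of \<open>[D, U, D]\<close> with \<open>R\<close> is
          \<open>5 + 2 * length B\<close>, since \<open>R\<close> is one shorter than
          \<open>B\<close>. The bound holds as \<open>A\<close> is \<open>[D, D]\<close> or has at
          least three steps and ends below 0.\<close>
        have len_A: "5 < 2 * int (length A) - height A (length A)"
        proof -
          have neg: "height A (length A) \<le> - 1"
            using A less.prems(2)[unfolded ends_low_def, rule_format, of "Suc 0"] by simp
          show ?thesis
          proof (cases A'')
            case Nil
            then show ?thesis using A A' neg by (cases z) auto
          next
            case Cons
            then show ?thesis using A A' neg by simp
          qed
        qed
        have left: "Q \<noteq> []" "ends_low Q" "Suc (length Q) = length A"
          "height Q (length Q) = height A (length A) + 1" if "Q \<in> left_turns A" for Q
        proof -
          note * = left_turns_above[OF less.prems(2,1) that stays_nonneg_Nil]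
          show "Q \<noteq> []" using *(1) A A' by auto
          show "ends_low Q" using that by (simp add: left_turns_def)
          show "Suc (length Q) = length A" "height Q (length Q) = height A (length A) + 1"
            using *(1,2) by auto
        qed
        have right: "stays_nonneg R" "length R = length B'" if "R \<in> right_turns B'" for R
          using that turn_length by (auto simp: right_turns_def)
        have left_U: "num_chains (Q @ [U]) = num_chains Q" if "Q \<in> left_turns A" for Q
          using IH[of Q "[U]"] left[OF that] stays_nonneg_U pos B
          by (simp add: num_chains_DU)
        have both: "num_chains (Q @ U # D # R) = num_chains Q * num_chains (D # R)"
          if Q: "Q \<in> left_turns A" and R: "R \<in> right_turns B'" for Q R
        proof -
          \<comment> \<open>The total length is the same as for \<open>A\<close> and
            \<open>B\<close>; the measure drops because \<open>Q\<close> ends one higher than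
            \<open>A\<close>.\<close>
          have "num_chains (Q @ U # D # R) = num_chains Q * num_chains (D # U # D # R)"
            using IH[of Q "U # D # R"] left[OF Q] right[OF R] stays_nonneg_UD[of R] pos B
            by simp
          also have "num_chains (D # U # D # R) = num_chains (D # R)"
            using IH[of "[D, U, D]" R] right[OF R] ends_low_DUD pos B len_A
            by (simp add: num_chains_DUD)
          finally show ?thesis .
        qed
        have "num_chains A = (\<Sum>Q \<in> left_turns A. num_chains (Q @ [U]))"
          using num_chains_rec[of A] fast_turns_append(2)[OF less.prems(2) A stays_nonneg_Nil]
          by (simp add: fast_turns_ends_low[OF less.prems(2) A] sum.reindex inj_on_def)
        also have "\<dots> = (\<Sum>Q \<in> left_turns A. num_chains Q)"
          using left_U by simp
        finally have f_A: "num_chains A = (\<Sum>Q \<in> left_turns A. num_chains Q)" .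
        \<comment> \<open>All left turns have length \<open>length A - 1\<close>, so the place of
          the cut can be recovered.\<close>
        have "inj_on (\<lambda>(Q, R). Q @ U # D # R) (left_turns A \<times> right_turns B')"
        proof (rule inj_onI)
          fix p q
          assume *: "p \<in> left_turns A \<times> right_turns B'" "q \<in> left_turns A \<times> right_turns B'"
            "(case p of (Q, R) \<Rightarrow> Q @ U # D # R) = (case q of (Q, R) \<Rightarrow> Q @ U # D # R)"
          then have "Suc (length (fst p)) = Suc (length (fst q))"
            using left(3)[of "fst p"] left(3)[of "fst q"] by (simp add: mem_Times_iff)
          then show "p = q" using * by (cases p; cases q) auto
        qed
        then have "num_chains (A @ B) =
            (\<Sum>(Q, R) \<in> left_turns A \<times> right_turns B'. num_chains (Q @ U # D # R))"
          using num_chains_rec[of "A @ B"] fast_turns_append(2)[OF less.prems(2) A nnB]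
          by (simp add: B fast_turns_append_U[OF less.prems(2) A nnB] sum.reindex
              case_prod_unfold)
        also have "\<dots> =
            (\<Sum>(Q, R) \<in> left_turns A \<times> right_turns B'. num_chains Q * num_chains (D # R))"
          using both by (intro sum.cong) auto
        also have "\<dots> = (\<Sum>Q \<in> left_turns A. num_chains Q) *
            (\<Sum>R \<in> right_turns B'. num_chains (D # R))"
          by (simp add: sum_product sum.cartesian_product)
        also have "\<dots> = num_chains A * num_chains (D # B)"
          using f_A num_chains_D_U[OF nnB] B by simp
        finally show ?thesis .
      qed
    qed
  qed
qed

section \<open>Application to Dyck suffixes and prefixes\<close>

lemma dyck_path_height_nonneg: "dyck_path P \<Longrightarrow> 0 \<le> height P i"
  using height_beyond[of P i] by (cases "i \<le> length P") (auto simp: dyck_path_def)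

text \<open>The end of the Dyck path \<open>R @ P\<close> has height 0, which is its minimum.
  Removing \<open>R\<close> shifts all heights along \<open>P\<close> by the same amount, so the end
  remains lowest.\<close>

lemma dyck_suffix_ends_low:
  assumes "dyck_suffix P"
  shows "ends_low P"
proof -
  obtain R where R: "dyck_path (R @ P)"
    using assms by (auto simp: dyck_suffix_def suffix_def)
  have "height P (length P) \<le> height P i" for i
  proof -
    have "height (R @ P) (length R + j) = height R (length R) + height P j" for j
      using height_beyond[of R "length R + j"] by (simp add: height_append)
    from this[of i] this[of "length P"] show ?thesis
      using dyck_path_height_nonneg[OF R, of "length R + i"] R by (simp add: dyck_path_def)
  qed
  then show ?thesis by (simp add: ends_low_def)
qed

lemma dyck_prefix_stays_nonneg:
  assumes "dyck_prefix P"
  shows "stays_nonneg P"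
proof -
  obtain R where R: "dyck_path (P @ R)"
    using assms by (auto simp: dyck_prefix_def prefix_def)
  have "0 \<le> height P i" if "i \<le> length P" for i
    using dyck_path_height_nonneg[OF R, of i] that by (simp add: height_append)
  then have "0 \<le> height P i" for i
    using height_beyond[of P i] by (cases "i \<le> length P") auto
  then show ?thesis by (simp add: stays_nonneg_def)
qed

theorem proposition9:
  fixes P P\<^sub>1 P\<^sub>2 :: path
  assumes "P = P\<^sub>1 @ P\<^sub>2"
    and "P\<^sub>1 \<noteq> []"
    and "dyck_suffix P\<^sub>1"
    and "dyck_prefix P\<^sub>2"
  shows "num_chains P = num_chains P\<^sub>1 * num_chains (D # P\<^sub>2)"
  using assms num_chains_append dyck_suffix_ends_low dyck_prefix_stays_nonneg by blast

end
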